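(* Let $\mathcal{M}=\mathcal{M}(J,\{n_k\},\{\phi_k\})$ be a Moran class in $\mathbb{R}^d$, where $\phi_k=(c_{k,1},\dots,c_{k,n_k})$, and suppose $c_*=\inf_{i,j}c_{i,j}>0$. For integers $k\ge0$ and $m\ge1$ let $s_{k,k+m}$ be the unique real solution $s$ of $$\prod_{i=k+1}^{k+m}\Big(\sum_{j=1}^{n_i}(c_{i,j})^s\Big)=1 .$$ Then the sequence $\{\sup_{k\ge0}s_{k,k+m}\}_{m=1}^\infty$ is convergent.
   Context: $|A|$ denotes the diameter of a set $A$, and $\mathrm{int}(A)$ its interior. Moran sets: let $\{n_k\}_{k\ge1}$ be a sequence of integers with $n_k\ge 2$. Let $D_k=\{u_1\cdots u_k: 1\le u_j\le n_j,\ j\le k\}$ be the set of words of length $k$, $D_0=\{\emptyset\}$ (the empty word), and $D=\bigcup_{k\ge0}D_k$. Let $J\subset\mathbb{R}^d$ be compact with $\mathrm{int}(J)\ne\varnothing$. For each $k\ge1$ let $\phi_k=(c_{k,1},\dots,c_{k,n_k})$ be a vector of positive reals with $\sum_{j=1}^{n_k}(c_{k,j})^d\le 1$. A collection $\mathcal{F}=\{J_{\mathbf u}:\mathbf u\in D\}$ of closed subsets of $J$ has the Moran structure if: (1) for each $\mathbf u\in D$ there is a similarity $S_{\mathbf u}:\mathbb{R}^d\to\mathbb{R}^d$ with $J_{\mathbf u}=S_{\mathbf u}(J)$, and $J_\emptyset=J$; (2) for all $k\ge1$ and $\mathbf u\in D_{k-1}$, the sets $J_{\mathbf u1},\dots,J_{\mathbf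 un_k}$ are subsets of $J_{\mathbf u}$ with pairwise disjoint interiors, and $|J_{\mathbf ui}|/|J_{\mathbf u}|=c_{k,i}$ for $1\le i\le n_k$. The associated Moran set is $\bigcap_{k\ge1}\bigcup_{\mathbf u\in D_k}J_{\mathbf u}$. The Moran class $\mathcal{M}(J,\{n_k\},\{\phi_k\})$ is the class of all Moran sets obtained in this way from the given $J,\{n_k\},\{\phi_k\}$. *)

theory Defs
  imports "HOL-Analysis.Analysis"
begin

text \<open>
  Sequences such as \<open>n\<^sub>k\<close> and \<open>c\<^sub>k\<^sub>,\<^sub>j\<close> are indexed by \<open>k \<ge> 1\<close> and \<open>1 \<le> j \<le> n\<^sub>k\<close>; they are represented
  by total functions whose values outside this range play no role.
\<close>

definition similarity :: "(real ^ 'd \<Rightarrow> real ^ 'd) \<Rightarrow> bool" where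
  "similarity S \<longleftrightarrow> (\<exists>r>0. \<forall>x y. dist (S x) (S y) = r * dist x y)"

text \<open>The letter \<open>u\<^sub>j\<close> of a word \<open>u\<close> is the list entry \<open>u ! (j - 1)\<close>.\<close>

definition words :: "(nat \<Rightarrow> nat) \<Rightarrow> nat \<Rightarrow> nat list set" where
  "words n k = {u. length u = k \<and> (\<forall>j\<in>{1..k}. u ! (j - 1) \<in> {1..n j})}"

definition all_words :: "(nat \<Rightarrow> nat) \<Rightarrow> nat list set" where
  "all_words n = (\<Union>k. words n k)"

definition moran_parameters ::
  "(real ^ 'd) set \<Rightarrow> (nat \<Rightarrow> nat) \<Rightarrow> (nat \<Rightarrow> nat \<Rightarrow> real) \<Rightarrow> bool" where
  "moran_parameters J n c \<longleftrightarrow>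
     compact J \<and> interior J \<noteq> {} \<and>
     (\<forall>k\<ge>1. n k \<ge> 2) \<and>
     (\<forall>k\<ge>1. \<forall>j\<in>{1..n k}. c k j > 0) \<and>
     (\<forall>k\<ge>1. (\<Sum>j=1..n k. c k j ^ CARD('d)) \<le> 1)"

definition moran_structure ::
  "(real ^ 'd) set \<Rightarrow> (nat \<Rightarrow> nat) \<Rightarrow> (nat \<Rightarrow> nat \<Rightarrow> real) \<Rightarrow>
    (nat list \<Rightarrow> (real ^ 'd) set) \<Rightarrow> bool" where
  "moran_structure J n c F \<longleftrightarrow>
     (\<forall>u\<in>all_words n. closed (F u) \<and> F u \<subseteq> J) \<and>
     (\<forall>u\<in>all_words n. \<exists>S. similarity S \<and> F u = S ` J) \<and>
     F [] = J \<and>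
     (\<forall>k\<ge>1. \<forall>u\<in>words n (k - 1).
        (\<forall>i\<in>{1..n k}. F (u @ [i]) \<subseteq> F u) \<and>
        (\<forall>i\<in>{1..n k}. \<forall>j\<in>{1..n k}. i \<noteq> j \<longrightarrow>
           interior (F (u @ [i])) \<inter> interior (F (u @ [j])) = {}) \<and>
        (\<forall>i\<in>{1..n k}. diameter (F (u @ [i])) / diameter (F u) = c k i))"

definition moran_set :: "(nat \<Rightarrow> nat) \<Rightarrow> (nat list \<Rightarrow> (real ^ 'd) set) \<Rightarrow> (real ^ 'd) set" where
  "moran_set n F = (\<Inter>k\<in>{1..}. \<Union>u\<in>words n k. F u)"

definition moran_class ::
  "(real ^ 'd) set \<Rightarrow> (nat \<Rightarrow> nat) \<Rightarrow> (nat \<Rightarrow> nat \<Rightarrow> real) \<Rightarrow> (real ^ 'd) set set" where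
  "moran_class J n c = {moran_set n F | F. moran_structure J n c F}"

definition c_star :: "(nat \<Rightarrow> nat) \<Rightarrow> (nat \<Rightarrow> nat \<Rightarrow> real) \<Rightarrow> real" where
  "c_star n c = Inf {c i j | i j. i \<ge> 1 \<and> j \<in> {1..n i}}"

definition moran_product ::
  "(nat \<Rightarrow> nat) \<Rightarrow> (nat \<Rightarrow> nat \<Rightarrow> real) \<Rightarrow> nat \<Rightarrow> nat \<Rightarrow> real \<Rightarrow> real" where
  "moran_product n c k l s = (\<Prod>i=k+1..l. \<Sum>j=1..n i. c i j powr s)"

definition moran_exponent ::
  "(nat \<Rightarrow> nat) \<Rightarrow> (nat \<Rightarrow> nat \<Rightarrow> real) \<Rightarrow> nat \<Rightarrow> nat \<Rightarrow> real" where
  "moran_exponent n c k l = (THE s. moran_product n c k l s = 1)"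

text \<open>
  The definite description above is meaningful for \<open>k < l\<close>, and the exponents are uniformly
  bounded, so that suprema of them are suprema of nonempty bounded sets of reals.
\<close>

lemma moran_coeff_less_1:
  fixes J :: "(real ^ 'd) set"
  assumes "moran_parameters J n c" "k \<ge> 1" "j \<in> {1..n k}"
  shows "c k j < 1"
proof (rule ccontr)
  assume "\<not> c k j < 1"
  hence ge: "c k j \<ge> 1" by simp
  from assms have n: "n k \<ge> 2" and pos: "\<And>i. i \<in> {1..n k} \<Longrightarrow> c k i > 0"
    and le: "(\<Sum>j=1..n k. c k j ^ CARD('d)) \<le> 1"
    by (auto simp: moran_parameters_def)
  define i where "i = (if j = 1 then 2 else 1 :: nat)"
  have i: "i \<in> {1..n k} - {j}" using n by (auto simp: i_def)
  have "0 < c k i ^ CARD('d)" using pos i by simp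
  also have "\<dots> \<le> (\<Sum>j\<in>{1..n k} - {j}. c k j ^ CARD('d))"
    by (rule member_le_sum[OF i]) (use pos in \<open>auto intro!: less_imp_le\<close>)
  finally have "c k j ^ CARD('d) < (\<Sum>j=1..n k. c k j ^ CARD('d))"
    using assms(3) by (subst sum.remove[of _ j]) auto
  with le one_le_power[OF ge, of "CARD('d)"] show False by linarith
qed

lemma moran_product_strict_antimono:
  assumes "moran_parameters J n c" "k < l" "s < t"
  shows "moran_product n c k l t < moran_product n c k l s"
proof -
  have "(\<Sum>j=1..n i. c i j powr t) < (\<Sum>j=1..n i. c i j powr s)"
       "0 < (\<Sum>j=1..n i. c i j powr t)" if "i \<in> {k+1..l}" for i
  proof -
    have i: "i \<ge> 1" using that by simp
    have n: "n i \<ge> 2" and pos: "\<And>j. j \<in> {1..n i} \<Longrightarrow> c i j > 0"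
      using assms(1) i by (auto simp: moran_parameters_def)
    show "0 < (\<Sum>j=1..n i. c i j powr t)"
      by (intro sum_pos) (use n pos in \<open>force+\<close>)
    show "(\<Sum>j=1..n i. c i j powr t) < (\<Sum>j=1..n i. c i j powr s)"
      by (intro sum_strict_mono powr_less_mono')
        (use n pos moran_coeff_less_1[OF assms(1) i] assms(3) in auto)
  qed
  thus ?thesis unfolding moran_product_def
    by (intro prod_mono_strict[of "Suc k"]) (use assms(2) in \<open>auto intro: less_imp_le less_trans\<close>)
qed

lemma moran_exponent_ex:
  fixes J :: "(real ^ 'd) set"
  assumes "moran_parameters J n c" "k < l"
  shows "\<exists>s\<ge>0. s \<le> real CARD('d) \<and> moran_product n c k l s = 1"
proof (rule IVT2)
  have pos: "c i j > 0" if "i \<ge> 1" "j \<in> {1..n i}" for i j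
    using assms(1) that by (auto simp: moran_parameters_def)
  show "moran_product n c k l (real CARD('d)) \<le> 1"
    unfolding moran_product_def
  proof (intro prod_le_1 conjI)
    fix i assume i: "i \<in> {k+1..l}"
    show "0 \<le> (\<Sum>j=1..n i. c i j powr real CARD('d))" by (intro sum_nonneg) auto
    have "(\<Sum>j=1..n i. c i j powr real CARD('d)) = (\<Sum>j=1..n i. c i j ^ CARD('d))"
      by (intro sum.cong refl powr_realpow pos) (use i in auto)
    thus "(\<Sum>j=1..n i. c i j powr real CARD('d)) \<le> 1"
      using assms(1) i by (auto simp: moran_parameters_def)
  qed
  show "1 \<le> moran_product n c k l 0"
    unfolding moran_product_def
  proof (intro prod_ge_1)
    fix i assume i: "i \<in> {k+1..l}"
    have "(\<Sum>j=1..n i. c i j powr 0) = (\<Sum>j=1..n i. 1)"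
      by (intro sum.cong refl) (use pos[of i] i in force)
    moreover have "n i \<ge> 2" using assms(1) i by (auto simp: moran_parameters_def)
    ultimately show "1 \<le> (\<Sum>j=1..n i. c i j powr 0)" by simp
  qed
  show "\<forall>x. 0 \<le> x \<and> x \<le> real CARD('d) \<longrightarrow> isCont (moran_product n c k l) x"
    unfolding moran_product_def
  proof (intro allI impI continuous_intros)
    fix i j assume "i \<in> {k+1..l}" "j \<in> {1..n i}"
    with pos[of i j] show "c i j \<noteq> 0" by simp
  qed
qed simp

lemma moran_exponent_ex1:
  assumes "moran_parameters J n c" "k < l"
  shows "\<exists>!s. moran_product n c k l s = 1"
proof -
  from moran_exponent_ex[OF assms] obtain s where "moran_product n c k l s = 1" by blast
  moreover have "s = t" if "moran_product n c k l s = 1" "moran_product n c k l t = 1" for s t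
    using moran_product_strict_antimono[OF assms, of s t]
      moran_product_strict_antimono[OF assms, of t s] that by (cases s t rule: linorder_cases) auto
  ultimately show ?thesis by blast
qed

lemma moran_exponent_bounds:
  fixes J :: "(real ^ 'd) set"
  assumes "moran_parameters J n c" "k < l"
  shows "moran_exponent n c k l \<in> {0..real CARD('d)}"
proof -
  from moran_exponent_ex[OF assms] obtain s
    where s: "s \<in> {0..real CARD('d)}" "moran_product n c k l s = 1" by auto
  have "moran_exponent n c k l = s" unfolding moran_exponent_def
    using s(2) moran_exponent_ex1[OF assms] by (rule the1_equality[rotated])
  with s(1) show ?thesis by simp
qed

end

theory Submission
  imports Defs
begin

text \<open>
  Let \<open>b\<^sub>m = sup\<^sub>k s\<^sub>k\<^sub>,\<^sub>k\<^sub>+\<^sub>m\<close> and split \<open>M = q m + r\<close> with \<open>r < m\<close>. At \<open>s = b\<^sub>m\<close> each of the \<open>q\<close> full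
  blocks of length \<open>m\<close> contributes a factor at most \<open>1\<close> to the product over \<open>k < i \<le> k + M\<close>, and the
  remaining \<open>r\<close> levels contribute at most \<open>N\<^sup>m\<close>, where \<open>N\<close> bounds all \<open>n\<^sub>i\<close>. As the ratios are bounded
  by some \<open>\<rho> < 1\<close>, raising \<open>s\<close> by \<open>\<delta>\<close> gains a factor \<open>\<rho>\<close> to the power \<open>\<delta> M\<close>, which beats \<open>N\<^sup>m\<close> for
  large \<open>M\<close>. Hence \<open>b\<^sub>M \<le> b\<^sub>m + \<delta>\<close> for all large \<open>M\<close>, and so \<open>b\<close> converges to its infimum.
\<close>

section \<open>Convergence criterion\<close>

text \<open>The second hypothesis says limsup b \<le> b m for every m, hence limsup b \<le> inf b
  \<le> liminf b. It takes the place of subadditivity in Fekete's argument.\<close>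

lemma convergent_if_eventually_le_add:
  fixes b :: "nat \<Rightarrow> real"
  assumes bdd: "bdd_below (range b)"
    and le: "\<And>m \<delta>. \<delta> > 0 \<Longrightarrow> eventually (\<lambda>M. b M \<le> b m + \<delta>) sequentially"
  shows "convergent b"
proof -
  have "b \<longlonglongrightarrow> (INF m. b m)"
  proof (rule order_tendstoI)
    fix a assume "a < (INF m. b m)"
    then show "eventually (\<lambda>M. a < b M) sequentially"
      by (intro always_eventually allI) (meson bdd cINF_lower UNIV_I less_le_trans)
  next
    fix a assume "(INF m. b m) < a"
    then obtain m where m: "b m < a"
      using cINF_less_iff[OF _ bdd] by auto
    \<comment> \<open>Half the gap between \<open>b m\<close> and \<open>a\<close> keeps the
      resulting bound strictly below \<open>a\<close>.\<close>
    show "eventually (\<lambda>M. b M < a) sequentially"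
      using le[of "(a - b m) / 2" m] m by (auto elim!: eventually_mono simp: field_simps)
  qed
  then show ?thesis by (rule convergentI)
qed

section \<open>Products and exponents\<close>

lemma moran_product_append:
  "moran_product n c k (k + p + q) s = moran_product n c k (k + p) s * moran_product n c (k + p) (k + p + q) s"
proof -
  have "{k + 1..k + p + q} = {k + 1..k + p} \<union> {k + p + 1..k + p + q}" by auto
  then show ?thesis unfolding moran_product_def
    by (simp only:) (intro prod.union_disjoint; auto)
qed

lemma moran_product_nonneg: "moran_product n c k l s \<ge> 0"
  unfolding moran_product_def by (intro prod_nonneg sum_nonneg) simp

lemma moran_product_exponent:
  assumes "moran_parameters J n c" "k < l"
  shows "moran_product n c k l (moran_exponent n c k l) = 1"
  unfolding moran_exponent_def by (rule theI'[OF moran_exponent_ex1[OF assms]])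

text \<open>Strict monotonicity in s turns bounds on exponents into bounds on products, which are
  multiplicative over blocks.\<close>

lemma moran_product_le_1_iff:
  assumes "moran_parameters J n c" "k < l"
  shows "moran_product n c k l s \<le> 1 \<longleftrightarrow> moran_exponent n c k l \<le> s"
  using moran_product_strict_antimono[OF assms, of s "moran_exponent n c k l"]
    moran_product_strict_antimono[OF assms, of "moran_exponent n c k l" s]
    moran_product_exponent[OF assms]
  by (cases s "moran_exponent n c k l" rule: linorder_cases) auto

lemma bdd_above_moran_exponent:
  assumes "moran_parameters (J :: (real ^ 'd) set) n c" "m > 0"
  shows "bdd_above (range (\<lambda>k. moran_exponent n c k (k + m)))"
  using moran_exponent_bounds[OF assms(1)] assms(2)
  by (intro bdd_aboveI[of _ "real CARD('d)"]) auto

lemma SUP_moran_exponent_nonneg: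
  assumes "moran_parameters J n c" "m > 0"
  shows "(SUP k. moran_exponent n c k (k + m)) \<ge> 0"
  using moran_exponent_bounds[OF assms(1), of 0 m] assms(2)
    cSUP_upper[OF UNIV_I[of 0] bdd_above_moran_exponent[OF assms]]
  by simp

lemma moran_product_blocks_le_1:
  assumes "moran_parameters J n c" "m > 0"
  shows "moran_product n c k (k + q * m) (SUP k. moran_exponent n c k (k + m)) \<le> 1"
proof (induction q)
  case 0
  then show ?case by (simp add: moran_product_def)
next
  case (Suc q)
  let ?s = "SUP k. moran_exponent n c k (k + m)"
  \<comment> \<open>The supremum runs over all starting levels, so it dominates the exponent of this
    block too.\<close>
  have "moran_product n c (k + q * m) (k + q * m + m) ?s \<le> 1"
    using assms cSUP_upper[OF UNIV_I bdd_above_moran_exponent[OF assms]]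
    by (simp add: moran_product_le_1_iff)
  then have "moran_product n c k (k + q * m + m) ?s \<le> 1"
    unfolding moran_product_append by (intro mult_le_one Suc.IH moran_product_nonneg)
  then show ?case by (simp add: algebra_simps)
qed

text \<open>Each term gains a factor \<open>c i j powr \<delta>\<close>, at most
  \<open>\<rho> powr \<delta>\<close>, so each of the m levels contributes that factor once.\<close>

lemma moran_product_add_le:
  assumes pos: "\<And>i j. i \<ge> 1 \<Longrightarrow> j \<in> {1..n i} \<Longrightarrow> c i j > 0"
    and le: "\<And>i j. i \<ge> 1 \<Longrightarrow> j \<in> {1..n i} \<Longrightarrow> c i j \<le> \<rho>"
    and "\<delta> \<ge> 0"
  shows "moran_product n c k (k + m) (s + \<delta>) \<le> (\<rho> powr \<delta>) ^ m * moran_product n c k (k + m) s"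
proof -
  have "moran_product n c k (k + m) (s + \<delta>)
      \<le> (\<Prod>i=k+1..k+m. \<rho> powr \<delta> * (\<Sum>j=1..n i. c i j powr s))"
    unfolding moran_product_def
  proof (intro prod_mono conjI)
    fix i assume i: "i \<in> {k+1..k+m}"
    show "(\<Sum>j=1..n i. c i j powr (s + \<delta>)) \<le> \<rho> powr \<delta> * (\<Sum>j=1..n i. c i j powr s)"
      unfolding sum_distrib_left
    proof (intro sum_mono)
      fix j assume j: "j \<in> {1..n i}"
      have "c i j powr \<delta> \<le> \<rho> powr \<delta>"
        using pos[of i j] le[of i j] i j assms(3) by (intro powr_mono2) auto
      then show "c i j powr (s + \<delta>) \<le> \<rho> powr \<delta> * c i j powr s"
        by (simp add: powr_add mult.commute mult_right_mono)
    qed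
  qed (intro sum_nonneg; simp)
  then show ?thesis by (simp add: moran_product_def prod.distrib)
qed

section \<open>Uniform bounds from the positive infimum of the ratios\<close>

lemma c_star_le:
  assumes "moran_parameters J n c" "i \<ge> 1" "j \<in> {1..n i}"
  shows "c_star n c \<le> c i j"
  unfolding c_star_def
proof (rule cInf_lower)
  show "c i j \<in> {c i j | i j. i \<ge> 1 \<and> j \<in> {1..n i}}"
    using assms(2,3) by blast
  show "bdd_below {c i j | i j. i \<ge> 1 \<and> j \<in> {1..n i}}"
  proof (rule bdd_belowI[of _ 0])
    fix x assume "x \<in> {c i j | i j. i \<ge> 1 \<and> j \<in> {1..n i}}"
    then obtain i j where "x = c i j" "i \<ge> 1" "j \<in> {1..n i}" by blast
    then show "0 \<le> x" using assms(1) by (auto simp: moran_parameters_def less_imp_le)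
  qed
qed

text \<open>Every ratio has a sibling on its level, whose d-th power is at least
  \<open>c_star n c ^ CARD('d)\<close>. As the d-th powers sum to at most 1, a fixed amount below 1
  is left for the ratio itself.\<close>

lemma moran_coeff_bound:
  fixes J :: "(real ^ 'd) set"
  assumes par: "moran_parameters J n c" and star: "c_star n c > 0"
  obtains \<rho> where "0 < \<rho>" "\<rho> < 1" "\<And>i j. i \<ge> 1 \<Longrightarrow> j \<in> {1..n i} \<Longrightarrow> c i j \<le> \<rho>"
proof -
  define \<gamma> where "\<gamma> = c_star n c ^ CARD('d)"
  have \<gamma>: "\<gamma> > 0" using star by (simp add: \<gamma>_def)
  have bound: "c i j ^ CARD('d) \<le> 1 - \<gamma>" if "i \<ge> 1" "j \<in> {1..n i}" for i j
  proof -
    have n: "n i \<ge> 2" and pos: "\<And>j. j \<in> {1..n i} \<Longrightarrow> c i j > 0"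
      and le: "(\<Sum>j=1..n i. c i j ^ CARD('d)) \<le> 1"
      using par that by (auto simp: moran_parameters_def)
    define j' where "j' = (if j = 1 then 2 else 1 :: nat)"
    have j': "j' \<in> {1..n i}" "j \<noteq> j'" using n by (auto simp: j'_def)
    have "c i j ^ CARD('d) + c i j' ^ CARD('d) = (\<Sum>j\<in>{j, j'}. c i j ^ CARD('d))"
      using j' by simp
    also have "\<dots> \<le> (\<Sum>j=1..n i. c i j ^ CARD('d))"
      by (intro sum_mono2) (use pos j' that in \<open>auto intro: less_imp_le\<close>)
    finally have "c i j ^ CARD('d) + c i j' ^ CARD('d) \<le> 1" using le by simp
    moreover have "\<gamma> \<le> c i j' ^ CARD('d)"
      unfolding \<gamma>_def using c_star_le[OF par that(1) j'(1)] star by (intro power_mono) auto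
    ultimately show ?thesis by simp
  qed
  have pos: "c i j > 0" if "i \<ge> 1" "j \<in> {1..n i}" for i j
    using par that by (auto simp: moran_parameters_def)
  have one: "(1::nat) \<in> {1..n 1}" using par by (force simp: moran_parameters_def)
  \<comment> \<open>Some ratio has to be exhibited to see that the root chosen as \<rho> below is
    positive.\<close>
  have "0 < c 1 1 ^ CARD('d)" using pos[OF _ one] by simp
  then have "1 - \<gamma> > 0" using bound[OF _ one] by simp
  then show thesis
  proof (intro that[of "root CARD('d) (1 - \<gamma>)"])
    fix i j assume ij: "i \<ge> (1::nat)" "j \<in> {1..n i}"
    have "c i j = root CARD('d) (c i j ^ CARD('d))"
      using pos[OF ij] by (simp add: real_root_power_cancel)
    then show "c i j \<le> root CARD('d) (1 - \<gamma>)"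
      using bound[OF ij] by (metis real_root_le_mono zero_less_card_finite)
  qed (use \<gamma> in auto)
qed

text \<open>For s \<ge> 0 a level sum is at most \<open>n i\<close>, and n_i copies of the smallest
  possible d-th power still sum to at most 1, which bounds \<open>n i\<close> uniformly.\<close>

lemma moran_product_le_power:
  fixes J :: "(real ^ 'd) set"
  assumes par: "moran_parameters J n c" and star: "c_star n c > 0" and "s \<ge> 0"
  shows "moran_product n c k (k + m) s \<le> (1 / c_star n c ^ CARD('d)) ^ m"
proof -
  have "moran_product n c k (k + m) s \<le> (\<Prod>i=k+1..k+m. 1 / c_star n c ^ CARD('d))"
    unfolding moran_product_def
  proof (intro prod_mono conjI)
    fix i assume i: "i \<in> {k+1..k+m}"
    then have i1: "i \<ge> 1" by simp
    have pos: "\<And>j. j \<in> {1..n i} \<Longrightarrow> c i j > 0"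
      and le: "(\<Sum>j=1..n i. c i j ^ CARD('d)) \<le> 1"
      using par i1 by (auto simp: moran_parameters_def)
    have "real (n i) * c_star n c ^ CARD('d) = (\<Sum>j=1..n i. c_star n c ^ CARD('d))" by simp
    also have "\<dots> \<le> (\<Sum>j=1..n i. c i j ^ CARD('d))"
      using c_star_le[OF par i1] star by (intro sum_mono power_mono) auto
    finally have n: "real (n i) \<le> 1 / c_star n c ^ CARD('d)"
      using le star by (simp add: field_simps)
    have "(\<Sum>j=1..n i. c i j powr s) \<le> (\<Sum>j=1..n i. 1)"
      using pos moran_coeff_less_1[OF par i1] assms(3)
      by (intro sum_mono powr_le1) (auto simp: abs_of_pos less_imp_le)
    with n show "(\<Sum>j=1..n i. c i j powr s) \<le> 1 / c_star n c ^ CARD('d)" by simp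
  qed (intro sum_nonneg; simp)
  then show ?thesis by simp
qed

section \<open>Comparison of suprema for different block lengths\<close>

lemma eventually_SUP_moran_exponent_le:
  fixes J :: "(real ^ 'd) set"
  assumes par: "moran_parameters J n c" and star: "c_star n c > 0" and m: "m > 0" and \<delta>: "\<delta> > 0"
  shows "eventually (\<lambda>M. (SUP k. moran_exponent n c k (k + M))
           \<le> (SUP k. moran_exponent n c k (k + m)) + \<delta>) sequentially"
proof -
  let ?s = "SUP k. moran_exponent n c k (k + m)"
  obtain \<rho> where \<rho>: "0 < \<rho>" "\<rho> < 1" "\<And>i j. i \<ge> 1 \<Longrightarrow> j \<in> {1..n i} \<Longrightarrow> c i j \<le> \<rho>"
    using moran_coeff_bound[OF par star] by blast
  define N where "N = 1 / c_star n c ^ CARD('d)"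
  have one: "(1::nat) \<in> {1..n 1}" using par by (force simp: moran_parameters_def)
  \<comment> \<open>This gives N \<ge> 1, so that the remainder bound \<open>N ^ r\<close> can be
    relaxed to \<open>N ^ m\<close>, which depends on neither M nor k.\<close>
  have "c_star n c \<le> 1"
    using c_star_le[OF par _ one] moran_coeff_less_1[OF par _ one] by simp
  then have N: "N \<ge> 1" using star by (simp add: N_def power_le_one)
  have "(\<lambda>M. (\<rho> powr \<delta>) ^ M * N ^ m) \<longlonglongrightarrow> 0 * N ^ m"
    using \<rho> \<delta> powr_less_mono2[of \<delta> \<rho> 1]
    by (intro tendsto_mult_right LIMSEQ_realpow_zero) auto
  then have "eventually (\<lambda>M. (\<rho> powr \<delta>) ^ M * N ^ m < 1) sequentially"
    by (rule order_tendstoD) simp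
  then show ?thesis
    \<comment> \<open>For M = 0 the product is empty and equals 1 at every s, so the exponent is not
      determined.\<close>
    using eventually_gt_at_top[of 0]
  proof eventually_elim
    case (elim M)
    show ?case
    proof (rule cSUP_least)
      fix k
      define q r where "q = M div m" and "r = M mod m"
      have M: "k + M = k + q * m + r" by (simp add: q_def r_def)
      have "moran_product n c k (k + M) ?s \<le> 1 * N ^ r"
        unfolding M moran_product_append N_def
        by (intro mult_mono moran_product_blocks_le_1[OF par m] moran_product_nonneg
            moran_product_le_power[OF par star SUP_moran_exponent_nonneg[OF par m]]) simp
      also have "\<dots> \<le> N ^ m"
        using N m by (simp add: r_def power_increasing less_imp_le)
      finally have "moran_product n c k (k + M) ?s \<le> N ^ m" .
      then have "(\<rho> powr \<delta>) ^ M * moran_product n c k (k + M) ?s \<le> (\<rho> powr \<delta>) ^ M * N ^ m"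
        by (intro mult_left_mono) auto
      moreover have "moran_product n c k (k + M) (?s + \<delta>)
          \<le> (\<rho> powr \<delta>) ^ M * moran_product n c k (k + M) ?s"
        by (intro moran_product_add_le)
          (use par \<rho> \<delta> in \<open>auto simp: moran_parameters_def\<close>)
      ultimately have "moran_product n c k (k + M) (?s + \<delta>) \<le> 1"
        using elim(1) by linarith
      then show "moran_exponent n c k (k + M) \<le> ?s + \<delta>"
        using moran_product_le_1_iff[OF par, of k "k + M"] elim(2) by simp
    qed simp
  qed
qed

theorem lemma3:
  fixes J :: "(real ^ 'd) set" and n :: "nat \<Rightarrow> nat" and c :: "nat \<Rightarrow> nat \<Rightarrow> real"
    and M :: "(real ^ 'd) set set"
  assumes "moran_parameters J n c"
    and "M = moran_class J n c"
    and "c_star n c > 0"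
  shows "convergent (\<lambda>m. SUP k. moran_exponent n c k (k + Suc m))"
proof (rule convergent_if_eventually_le_add)
  show "bdd_below (range (\<lambda>m. SUP k. moran_exponent n c k (k + Suc m)))"
    using SUP_moran_exponent_nonneg[OF assms(1) zero_less_Suc]
    by (intro bdd_belowI[of _ 0]) (auto simp del: add_Suc_right)
next
  fix m and \<delta> :: real
  assume "\<delta> > 0"
  from eventually_SUP_moran_exponent_le[OF assms(1,3) zero_less_Suc this]
  show "eventually (\<lambda>M. (SUP k. moran_exponent n c k (k + Suc M))
      \<le> (SUP k. moran_exponent n c k (k + Suc m)) + \<delta>) sequentially"
    \<comment> \<open>The index shift makes the sequence start at block length 1; eventual
      statements are unaffected by it.\<close>
    by (subst eventually_sequentially_Suc)
qed

end
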